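(* Let $d$ and $\Delta$ be positive integers and $\epsilon>0$. Suppose $n\ge 2^9\epsilon^{-3}d^9\Delta^3$, $H$ is a $(d+1)$-uniform hypergraph with $n$ vertices, maximum degree at most $\Delta$ and no isolated vertices, and $P$ is a set of $n$ points in $\mathbb{R}^d$ such that no point of $\mathbb{R}^d$ lies in more than a fraction $c$ of the $\binom{n}{d+1}$ closed simplices with vertices in $P$. Then there is a bijection $f:V(H)\to P$ such that no point of $\mathbb{R}^d$ lies in more than a fraction $c+\epsilon$ of the simplices $\mathrm{conv}(f(e))$, $e\in E(H)$.
   Context: The degree of a vertex is the number of hyperedges containing it; a vertex is isolated if its degree is $0$. The paper adopts the convention that point sets are in general position. *)

theory Defs
  imports "HOL-Analysis.Analysis"
begin

definition uniform_hypergraph :: "nat \<Rightarrow> 'v set \<Rightarrow> 'v set set \<Rightarrow> bool" where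
  "uniform_hypergraph k V E \<longleftrightarrow> finite V \<and> (\<forall>e\<in>E. e \<subseteq> V \<and> card e = k)"

definition hdegree :: "'v set set \<Rightarrow> 'v \<Rightarrow> nat" where
  "hdegree E v = card {e \<in> E. v \<in> e}"

definition isolated_vertex :: "'v set set \<Rightarrow> 'v \<Rightarrow> bool" where
  "isolated_vertex E v \<longleftrightarrow> hdegree E v = 0"

text \<open>For a set with at least \<open>d + 1\<close> points in dimension \<open>d\<close> this is the usual
  condition that no \<open>d + 1\<close> of them lie on a common hyperplane.\<close>

definition general_position :: "'a::euclidean_space set \<Rightarrow> bool" where
  "general_position P \<longleftrightarrow>
     (\<forall>S. S \<subseteq> P \<and> finite S \<and> card S \<le> DIM('a) + 1 \<longrightarrow> \<not> affine_dependent S)"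

end

theory Submission
  imports Defs "HOL-Probability.Hoeffding"
begin

text \<open>A uniformly random bijection works. For a fixed point the expected number of edges whose
  simplex contains it is at most \<open>c * card E\<close>. Transposing two values of the bijection changes
  that number by at most \<open>2 * \<Delta>\<close>, so revealing the values one at a time and applying Hoeffding's
  lemma to each step bounds its exponential moments (Azuma's inequality for permutations).
  Only polynomially many points have to be controlled: an extreme point of the intersection of all
  simplices containing \<open>x\<close> lies in all of these simplices, and it is determined by \<open>d\<close> faces, so
  there are at most \<open>n ^ (d * (d + 1))\<close> such extreme points. Averaging the sum of the exponential
  moments over these points then yields one bijection that is good for all of them.\<close>

subsection \<open>Random bijections\<close>

text \<open>Extensionality makes each bijection count only once, so that for finite sets of equal
  size uniform averages are sums divided by \<open>fact (card V)\<close>.\<close>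

definition bijs :: "'v set \<Rightarrow> 'p set \<Rightarrow> ('v \<Rightarrow> 'p) set" where
  "bijs V P = {f \<in> V \<rightarrow>\<^sub>E P. bij_betw f V P}"

lemma finite_bijs: "finite V \<Longrightarrow> finite P \<Longrightarrow> finite (bijs V P)"
  by (auto simp: bijs_def intro: finite_PiE finite_subset[of _ "V \<rightarrow>\<^sub>E P"])

lemma bijs_restrict: "bij_betw f V P \<Longrightarrow> restrict f V \<in> bijs V P"
  by (auto simp: bijs_def bij_betw_apply cong: bij_betw_cong)

lemma bijs_fun_upd:
  assumes "v \<notin> V" "p \<in> P" "f \<in> bijs V (P - {p})"
  shows "f(v := p) \<in> bijs (insert v V) P"
proof -
  have "bij_betw (f(v := p)) V (P - {p})"
    using assms by (subst bij_betw_cong[where g = f]) (auto simp: bijs_def)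
  then have "bij_betw (f(v := p)) (insert v V) (insert p (P - {p}))"
    using notIn_Un_bij_betw[of v V "f(v := p)" "P - {p}"] assms(1) by simp
  then show ?thesis
    using assms by (auto simp: bijs_def insert_absorb PiE_iff extensional_def)
qed

lemma bijs_fun_upd_undefined:
  assumes "v \<notin> V" "f \<in> bijs (insert v V) P"
  shows "f(v := undefined) \<in> bijs V (P - {f v})"
proof -
  have f: "bij_betw f (insert v V) P" "f \<in> insert v V \<rightarrow>\<^sub>E P"
    using assms(2) by (auto simp: bijs_def)
  have "bij_betw f V (P - {f v})"
    using notIn_Un_bij_betw3[of v V f "P - {f v}"] f assms(1) by (simp add: insert_absorb PiE_iff)
  then have b: "bij_betw (f(v := undefined)) V (P - {f v})"
    using assms(1) by (subst bij_betw_cong[where g = f]) auto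
  then show ?thesis
    using f(2) bij_betw_apply[OF b] by (auto simp: bijs_def PiE_iff extensional_def)
qed

text \<open>Conditioning on the value at \<open>v\<close>, which drives the inductions on
  \<open>V\<close>. Forgetting that value means resetting it to \<open>undefined\<close>, so that
  the rest is extensional on \<open>V\<close>.\<close>

lemma sum_bijs_insert:
  assumes "finite V" "finite P" "v \<notin> V"
  shows "(\<Sum>f\<in>bijs (insert v V) P. h f) = (\<Sum>p\<in>P. \<Sum>f\<in>bijs V (P - {p}). h (f(v := p)))"
proof -
  have "(\<Sum>f\<in>bijs (insert v V) P. h f)
      = (\<Sum>(p, f)\<in>(SIGMA p:P. bijs V (P - {p})). h (f(v := p)))"
  proof (rule sum.reindex_bij_witness[where j = "\<lambda>f. (f v, f(v := undefined))"
        and i = "\<lambda>(p, f). f(v := p)"], goal_cases)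
    case (2 f)
    then show ?case
      using bijs_fun_upd_undefined[OF assms(3) 2] by (auto simp: bijs_def)
  next
    case (3 b)
    then show ?case using assms(3) by (auto simp: bijs_def PiE_iff extensional_def fun_eq_iff)
  next
    case (4 b)
    then show ?case using bijs_fun_upd[OF assms(3)] by auto
  qed auto
  then show ?thesis
    using assms by (simp add: sum.Sigma finite_bijs)
qed

lemma bijs_empty: "bijs {} {} = {\<lambda>_. undefined}"
  by (auto simp: bijs_def bij_betw_def)

lemma card_bijs:
  assumes "finite V" "finite P" "card V = card P"
  shows "card (bijs V P) = fact (card V)"
  using assms
proof (induction V arbitrary: P rule: finite_induct)
  case empty
  then show ?case by (simp add: bijs_empty)
next
  case (insert v V)
  have "card (bijs V (P - {p})) = fact (card V)" if "p \<in> P" for p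
    using insert that by (intro insert.IH) auto
  moreover have "card (bijs (insert v V) P) = (\<Sum>p\<in>P. card (bijs V (P - {p})))"
    using sum_bijs_insert[OF insert(1,4,2), of "\<lambda>_. 1 :: nat"] by simp
  moreover have "card P = Suc (card V)" using insert by simp
  ultimately show ?case using insert(1,2) by simp
qed

section \<open>Exponential moments of a function of a random bijection\<close>

text \<open>Hoeffding's lemma for the uniform distribution on \<open>A\<close>, as finite sums. Only
  differences of values are bounded, so the interval runs from the minimum to the maximum of
  \<open>x\<close> and has length at most \<open>c\<close>.\<close>

lemma Hoeffding_lemma_uniform:
  fixes x :: "'p \<Rightarrow> real"
  assumes "finite A" "A \<noteq> {}" "l > 0"
    and osc: "\<And>a b. a \<in> A \<Longrightarrow> b \<in> A \<Longrightarrow> x a - x b \<le> c"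
  shows "(\<Sum>a\<in>A. exp (l * (x a - (\<Sum>a\<in>A. x a) / card A))) \<le> card A * exp (l\<^sup>2 * c\<^sup>2 / 8)"
proof -
  define a b where "a = Min (x ` A)" and "b = Max (x ` A)"
  have "a \<in> x ` A" "b \<in> x ` A"
    unfolding a_def b_def using assms by (auto intro!: Min_in Max_in simp del: Min_in Max_in)
  then have "b - a \<le> c" using osc by auto
  have ab: "a \<le> x p" "x p \<le> b" if "p \<in> A" for p
    using assms that by (auto simp: a_def b_def)
  have "a \<le> b" using ab assms(2) by fastforce
  let ?M = "measure_pmf (pmf_of_set A)"
  interpret interval_bounded_random_variable ?M x a b
    using assms(1,2) ab by unfold_locales (auto simp: AE_measure_pmf_iff)
  have pos: "real (card A) > 0" using assms by (simp add: card_gt_0_iff)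
  have E: "measure_pmf.expectation (pmf_of_set A) x = (\<Sum>a\<in>A. x a) / card A"
    by (rule integral_pmf_of_set[OF assms(2,1)])
  let ?s = "\<Sum>p\<in>A. exp (l * (x p - measure_pmf.expectation (pmf_of_set A) x))"
  have "ennreal (?s / card A) = (\<Sum>p\<in>A. ennreal (exp (l * (x p - measure_pmf.expectation (pmf_of_set A) x)))) / card A"
    using pos by (simp add: divide_ennreal[symmetric] sum_nonneg sum_ennreal ennreal_of_nat_eq_real_of_nat)
  also have "\<dots> = (\<integral>\<^sup>+p. ennreal (exp (l * (x p - measure_pmf.expectation (pmf_of_set A) x))) \<partial>?M)"
    using assms by (subst nn_integral_pmf_of_set) auto
  also have "\<dots> \<le> ennreal (exp (l\<^sup>2 * (b - a)\<^sup>2 / 8))"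
    using Hoeffdings_lemma_nn_integral[OF assms(3)] by (simp add: algebra_simps)
  finally have "?s / card A \<le> exp (l\<^sup>2 * (b - a)\<^sup>2 / 8)"
    by (simp add: ennreal_le_iff)
  also have "\<dots> \<le> exp (l\<^sup>2 * c\<^sup>2 / 8)"
    using \<open>a \<le> b\<close> \<open>b - a \<le> c\<close> by (simp add: mult_left_mono power_mono)
  finally show ?thesis
    using pos by (simp add: E divide_simps mult.commute)
qed

text \<open>Conditioning on the value at \<open>v\<close> splits the exponential into two factors:
  the deviation of the conditional mean from \<open>\<mu>\<close>, controlled by Hoeffding's lemma,
  and the deviation from the conditional mean, controlled by induction. Each revealed value costs a
  factor \<open>exp (l\<^sup>2 * c\<^sup>2 / 8)\<close>.\<close>

lemma exp_moment_bijs: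
  fixes g :: "('v \<Rightarrow> 'p) \<Rightarrow> real"
  assumes "finite V" "finite P" "card V = card P" "l > 0" "c \<ge> 0"
    and "\<And>f f' a b. f \<in> bijs V P \<Longrightarrow> f' \<in> bijs V P \<Longrightarrow> (\<And>u. u \<in> V - {a, b} \<Longrightarrow> f u = f' u)
           \<Longrightarrow> g f - g f' \<le> c"
  shows "(\<Sum>f\<in>bijs V P. exp (l * (g f - (\<Sum>f\<in>bijs V P. g f) / fact (card V))))
           \<le> fact (card V) * exp (card V * (l\<^sup>2 * c\<^sup>2 / 8))"
  using assms(1-3,6)
proof (induction V arbitrary: P g rule: finite_induct)
  case empty
  then show ?case by (simp add: bijs_empty)
next
  case (insert v V)
  define n where "n = card V"
  define K where "K = l\<^sup>2 * c\<^sup>2 / 8"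
  define m where "m p = (\<Sum>f\<in>bijs V (P - {p}). g (f(v := p))) / fact n" for p
  define \<mu> where "\<mu> = (\<Sum>f\<in>bijs (insert v V) P. g f) / fact (Suc n)"
  have cP: "card P = Suc n" "P \<noteq> {}" and cV: "card (insert v V) = Suc n"
    using insert by (auto simp: n_def)
  have cPp: "card (P - {p}) = n" if "p \<in> P" for p
    using that cP insert by simp
  note split = sum_bijs_insert[OF insert(1,4,2)]
  have \<mu>: "\<mu> = (\<Sum>p\<in>P. m p) / card P"
    by (simp add: \<mu>_def split m_def sum_divide_distrib[symmetric] cP)
  have osc: "m p - m q \<le> c" if p: "p \<in> P" and q: "q \<in> P" for p q
  proof (cases "p = q")
    case True
    then show ?thesis using assms(5) by simp
  next
    case False
    \<comment> \<open>A coupling of the two conditional distributions: \<open>\<phi> p q\<close>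
      replaces the value \<open>q\<close> by \<open>p\<close>. Then \<open>f(v := p)\<close> and
      \<open>(\<phi> p q f)(v := q)\<close> differ only by swapping the values at \<open>v\<close>
      and at the preimage of \<open>q\<close>.\<close>
    define \<phi> where "\<phi> a b f = restrict (\<lambda>u. if f u = b then a else f u) V" for a b :: 'p and f :: "'v \<Rightarrow> 'p"
    have mem: "\<phi> a b f \<in> bijs V (P - {b})" if "f \<in> bijs V (P - {a})" "a \<in> P" "b \<in> P" "a \<noteq> b" for a b f
    proof -
      have f: "bij_betw f V (P - {a})" using that by (simp add: bijs_def)
      have "bij_betw (\<lambda>x. if x = b then a else x) (P - {a}) (P - {b})"
        by (rule bij_betw_byWitness[where f' = "\<lambda>x. if x = a then b else x"]) (use that in auto)
      from bij_betw_trans[OF f this] show ?thesis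
        unfolding \<phi>_def by (intro bijs_restrict) (simp add: o_def)
    qed
    have inv: "\<phi> b a (\<phi> a b f) = f" if "f \<in> bijs V (P - {a})" "a \<noteq> b" for a b f
      using that by (auto simp: \<phi>_def bijs_def fun_eq_iff PiE_iff extensional_def)
    have "(\<Sum>f\<in>bijs V (P - {q}). g (f(v := q))) = (\<Sum>f\<in>bijs V (P - {p}). g ((\<phi> p q f)(v := q)))"
      by (rule sum.reindex_bij_witness[where j = "\<phi> q p" and i = "\<phi> p q"])
        (use mem inv p q False in auto)
    then have "m p - m q = (\<Sum>f\<in>bijs V (P - {p}). g (f(v := p)) - g ((\<phi> p q f)(v := q))) / fact n"
      by (simp add: m_def sum_subtractf diff_divide_distrib)
    also have "\<dots> \<le> (\<Sum>f\<in>bijs V (P - {p}). c) / fact n"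
    proof (intro divide_right_mono sum_mono)
      fix f assume f: "f \<in> bijs V (P - {p})"
      then have "f ` V = P - {p}" by (simp add: bijs_def bij_betw_def)
      then obtain b where b: "b \<in> V" "f b = q"
        using q False by (metis Diff_iff imageE singletonD)
      have b': "u = b" if "u \<in> V" "f u = q" for u
        using f b that by (auto simp: bijs_def bij_betw_def inj_on_def)
      show "g (f(v := p)) - g ((\<phi> p q f)(v := q)) \<le> c"
      proof (rule insert.prems(3)[where a = v and b = b])
        show "f(v := p) \<in> bijs (insert v V) P"
          by (rule bijs_fun_upd[OF insert(2) p f])
        show "(\<phi> p q f)(v := q) \<in> bijs (insert v V) P"
          by (rule bijs_fun_upd[OF insert(2) q mem[OF f p q False]])
      qed (use b' in \<open>auto simp: \<phi>_def\<close>)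
    qed auto
    also have "\<dots> = c"
      using card_bijs[OF insert(1), of "P - {p}"] cPp[OF p] insert(4) by (simp add: n_def)
    finally show ?thesis .
  qed
  have IH: "(\<Sum>f\<in>bijs V (P - {p}). exp (l * (g (f(v := p)) - m p))) \<le> fact n * exp (n * K)"
    if p: "p \<in> P" for p
    unfolding m_def n_def K_def
  proof (rule insert.IH)
    show "g (f(v := p)) - g (f'(v := p)) \<le> c"
      if "f \<in> bijs V (P - {p})" "f' \<in> bijs V (P - {p})" "\<And>u. u \<in> V - {a, b} \<Longrightarrow> f u = f' u"
      for f f' a b
    proof (rule insert.prems(3)[where a = a and b = b])
      show "f(v := p) \<in> bijs (insert v V) P" "f'(v := p) \<in> bijs (insert v V) P"
        using that bijs_fun_upd[OF insert(2) p] by blast+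
    qed (use that in auto)
  qed (use insert p in auto)
  have "(\<Sum>f\<in>bijs (insert v V) P. exp (l * (g f - \<mu>)))
      = (\<Sum>p\<in>P. exp (l * (m p - \<mu>)) * (\<Sum>f\<in>bijs V (P - {p}). exp (l * (g (f(v := p)) - m p))))"
    by (simp add: split sum_distrib_left exp_add[symmetric] algebra_simps)
  also have "\<dots> \<le> (\<Sum>p\<in>P. exp (l * (m p - \<mu>)) * (fact n * exp (n * K)))"
    by (intro sum_mono mult_left_mono IH) auto
  also have "\<dots> = (\<Sum>p\<in>P. exp (l * (m p - \<mu>))) * (fact n * exp (n * K))"
    by (simp add: sum_distrib_right)
  also have "\<dots> \<le> (card P * exp K) * (fact n * exp (n * K))"
    unfolding \<mu> K_def by (intro mult_right_mono Hoeffding_lemma_uniform) (use osc insert cP assms in auto)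
  also have "\<dots> = fact (Suc n) * exp (Suc n * K)"
    by (simp add: cP algebra_simps exp_add)
  finally show ?case
    by (simp only: cV \<mu>_def K_def)
qed

section \<open>The distribution of the image of a fixed edge\<close>

text \<open>The image of \<open>e\<close> under a random bijection is uniform among the subsets of
  \<open>P\<close> of size \<open>card e\<close>. The equality of probabilities is cross-multiplied
  to stay in the natural numbers.\<close>

lemma card_bijs_image:
  assumes "finite V" "finite P" "card V = card P" "e \<subseteq> V"
  shows "card {f \<in> bijs V P. Q (f ` e)} * (card V choose card e)
           = fact (card V) * card {S. S \<subseteq> P \<and> card S = card e \<and> Q S}"
proof -
  define N where "N S = card {f \<in> bijs V P. f ` e = S}" for S
  define \<S> where "\<S> = {S. S \<subseteq> P \<and> card S = card e}"
  have fin: "finite \<S>" using assms by (auto simp: \<S>_def)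
  \<comment> \<open>A bijection from \<open>S\<close> to \<open>S'\<close> and one between the
    complements form a permutation of \<open>P\<close>; composing with it is injective and turns the
    image \<open>S\<close> into \<open>S'\<close>. By symmetry, \<open>N\<close> is constant on
    \<open>\<S>\<close>.\<close>
  have N_le: "N S \<le> N S'" if S: "S \<in> \<S>" "S' \<in> \<S>" for S S'
  proof -
    have fS: "finite S" "finite S'" using S assms by (auto simp: \<S>_def intro: finite_subset)
    obtain h1 where h1: "bij_betw h1 S S'"
      using finite_same_card_bij[OF fS] S by (auto simp: \<S>_def)
    have "card (P - S) = card (P - S')"
      using S fS assms by (simp add: \<S>_def card_Diff_subset)
    then obtain h2 where h2: "bij_betw h2 (P - S) (P - S')"
      using finite_same_card_bij assms by (metis finite_Diff)
    define \<pi> where "\<pi> x = (if x \<in> S then h1 x else h2 x)" for x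
    have "bij_betw \<pi> (S \<union> (P - S)) (S' \<union> (P - S'))"
      unfolding \<pi>_def using h1 h2 by (rule bij_betw_disjoint_Un) auto
    then have \<pi>: "bij_betw \<pi> P P" using S by (simp add: \<S>_def Un_absorb1)
    have \<pi>S: "\<pi> ` S = S'" using h1 by (auto simp: \<pi>_def bij_betw_def)
    have "inj_on (\<lambda>f. restrict (\<pi> \<circ> f) V) {f \<in> bijs V P. f ` e = S}"
    proof (rule inj_onI)
      fix f f' assume f: "f \<in> {f \<in> bijs V P. f ` e = S}" "f' \<in> {f \<in> bijs V P. f ` e = S}"
        and eq: "restrict (\<pi> \<circ> f) V = restrict (\<pi> \<circ> f') V"
      have "f u = f' u" if "u \<in> V" for u
      proof -
        have "\<pi> (f u) = \<pi> (f' u)" using fun_cong[OF eq, of u] that by simp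
        moreover have "f u \<in> P" "f' u \<in> P" using f that by (auto simp: bijs_def)
        ultimately show ?thesis using \<pi> by (auto simp: bij_betw_def inj_on_def)
      qed
      then show "f = f'" using f by (auto simp: bijs_def intro: PiE_ext)
    qed
    moreover have "(\<lambda>f. restrict (\<pi> \<circ> f) V) ` {f \<in> bijs V P. f ` e = S} \<subseteq> {f \<in> bijs V P. f ` e = S'}"
    proof safe
      fix f assume f: "f \<in> bijs V P" "S = f ` e"
      then show "restrict (\<pi> \<circ> f) V \<in> bijs V P"
        by (intro bijs_restrict bij_betw_trans[OF _ \<pi>]) (simp add: bijs_def)
      have "restrict (\<pi> \<circ> f) V ` e = \<pi> ` f ` e"
        using assms(4) by (force simp: image_iff)
      then have im: "restrict (\<pi> \<circ> f) V ` e = S'" using f \<pi>S by simp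
      fix x
      show "x \<in> S' \<Longrightarrow> x \<in> restrict (\<pi> \<circ> f) V ` e" using im by simp
      show "u \<in> e \<Longrightarrow> restrict (\<pi> \<circ> f) V u \<in> S'" for u using im by blast
    qed
    ultimately show ?thesis
      unfolding N_def using finite_bijs[OF assms(1,2)] by (intro card_inj_on_le) auto
  qed
  have sum_N: "card {f \<in> bijs V P. f ` e \<in> A} = (\<Sum>S\<in>A. N S)" if "A \<subseteq> \<S>" for A
  proof -
    have "{f \<in> bijs V P. f ` e \<in> A} = (\<Union>S\<in>A. {f \<in> bijs V P. f ` e = S})" by auto
    then show ?thesis
      unfolding N_def using finite_bijs[OF assms(1,2)] finite_subset[OF that fin]
      by (simp only:) (intro card_UN_disjoint, auto)
  qed
  have img: "f ` e \<in> \<S>" if "f \<in> bijs V P" for f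
  proof -
    have "inj_on f e" using that assms(4) by (auto simp: bijs_def bij_betw_def intro: inj_on_subset)
    then show ?thesis using that assms(4) by (auto simp: \<S>_def bijs_def card_image)
  qed
  let ?A = "{S \<in> \<S>. Q S}"
  have Q: "card {f \<in> bijs V P. Q (f ` e)} = (\<Sum>S\<in>?A. N S)"
    using sum_N[of ?A] img by (simp cong: conj_cong)
  have all: "fact (card V) = (\<Sum>S\<in>\<S>. N S)"
    using sum_N[of \<S>] img card_bijs[OF assms(1-3)] by (simp cong: conj_cong)
  have cS: "card \<S> = card V choose card e"
    unfolding \<S>_def using n_subsets[OF assms(2)] assms(3) by simp
  have eq: "?A = {S. S \<subseteq> P \<and> card S = card e \<and> Q S}" by (auto simp: \<S>_def)
  show ?thesis
  proof (cases "\<S> = {}")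
    \<comment> \<open>This case is vacuous: \<open>all\<close> would read
      \<open>fact (card V) = 0\<close>.\<close>
    case True
    then show ?thesis using all by simp
  next
    case False
    then obtain T where T: "T \<in> \<S>" by blast
    have const: "N S = N T" if "S \<in> \<S>" for S using N_le that T by (meson le_antisym)
    have "(\<Sum>S\<in>?A. N S) = card ?A * N T" "(\<Sum>S\<in>\<S>. N S) = card \<S> * N T"
      using const by simp_all
    then show ?thesis using Q all cS eq by simp
  qed
qed

subsection \<open>Extreme points of intersections of simplices\<close>

text \<open>\<open>F\<close> is the support of the barycentric coordinates of \<open>v\<close>: over
  an affinely independent set, strictly positive coordinates describe the relative interior of the
  hull.\<close>

lemma convex_hull_rel_interior_subset:
  fixes S :: "'a::euclidean_space set"
  assumes "\<not> affine_dependent S" "v \<in> convex hull S"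
  obtains F where "F \<subseteq> S" "v \<in> rel_interior (convex hull F)"
proof -
  have fin: "finite S" using assms(1) aff_independent_finite by blast
  obtain u where u: "\<And>x. x \<in> S \<Longrightarrow> 0 \<le> u x" "sum u S = 1" "(\<Sum>x\<in>S. u x *\<^sub>R x) = v"
    using assms(2) fin by (auto simp: convex_hull_finite)
  define F where "F = {x \<in> S. u x \<noteq> 0}"
  have "sum u F = 1" "(\<Sum>x\<in>F. u x *\<^sub>R x) = v"
    using u(2,3) fin by (auto simp: F_def intro!: sum.mono_neutral_cong_left trans[OF _ u(2)] trans[OF _ u(3)])
  moreover have "\<forall>x\<in>F. 0 < u x" using u(1) by (force simp: F_def less_le)
  moreover have "\<not> affine_dependent F"
    using assms(1) affine_dependent_subset[of F S] by (auto simp: F_def)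
  ultimately have "v \<in> rel_interior (convex hull F)"
    by (auto simp: rel_interior_convex_hull_explicit)
  then show ?thesis by (intro that[of F]) (auto simp: F_def)
qed

text \<open>If the affine hulls shared a second point \<open>y\<close>, a short move from
  \<open>v\<close> along the line through \<open>y\<close>, in either direction, would stay in every
  \<open>D i\<close>. Then \<open>v\<close> would be the midpoint of a segment in the intersection
  of the \<open>C i\<close>.\<close>

lemma extreme_point_Inter_affine_hulls:
  fixes C :: "'i \<Rightarrow> 'a::euclidean_space set"
  assumes "finite I" "v extreme_point_of (\<Inter>i\<in>I. C i)"
    and ri: "\<And>i. i \<in> I \<Longrightarrow> v \<in> rel_interior (D i)" "\<And>i. i \<in> I \<Longrightarrow> D i \<subseteq> C i"
  shows "(\<Inter>i\<in>I. affine hull (D i)) = {v}"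
proof -
  have "y = v" if y: "y \<in> (\<Inter>i\<in>I. affine hull (D i))" for y
  proof (rule ccontr)
    assume "y \<noteq> v"
    have "\<forall>i\<in>I. \<exists>r>0. cball v r \<inter> affine hull (D i) \<subseteq> D i"
      using ri(1) by (auto simp: mem_rel_interior_cball)
    then obtain r where r: "\<And>i. i \<in> I \<Longrightarrow> r i > 0"
        "\<And>i. i \<in> I \<Longrightarrow> cball v (r i) \<inter> affine hull (D i) \<subseteq> D i"
      by metis
    \<comment> \<open>The extra \<open>1\<close> keeps the minimum well defined when
      \<open>I\<close> is empty.\<close>
    define \<rho> where "\<rho> = Min (insert 1 (r ` I))"
    have \<rho>: "\<rho> > 0" "\<And>i. i \<in> I \<Longrightarrow> \<rho> \<le> r i"
      using assms(1) r(1) by (auto simp: \<rho>_def)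
    define t where "t = \<rho> / norm (y - v)"
    have t: "t > 0" "t * norm (y - v) = \<rho>"
      using \<rho>(1) \<open>y \<noteq> v\<close> by (auto simp: t_def)
    have mem: "v + s *\<^sub>R (y - v) \<in> (\<Inter>i\<in>I. C i)" if "\<bar>s\<bar> = t" for s
    proof
      fix i assume i: "i \<in> I"
      have "v \<in> affine hull (D i)"
        using ri(1)[OF i] rel_interior_subset hull_subset by (metis subsetD)
      then have "(1 - s) *\<^sub>R v + s *\<^sub>R y \<in> affine hull (D i)"
        using y i by (intro mem_affine[OF affine_affine_hull]) auto
      then have "v + s *\<^sub>R (y - v) \<in> affine hull (D i)"
        by (simp add: algebra_simps)
      moreover have "v + s *\<^sub>R (y - v) \<in> cball v (r i)"
        using t \<rho>(2)[OF i] that by (simp add: dist_norm)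
      ultimately show "v + s *\<^sub>R (y - v) \<in> C i" using r(2)[OF i] ri(2)[OF i] by blast
    qed
    have "v = midpoint (v + t *\<^sub>R (y - v)) (v + (- t) *\<^sub>R (y - v))"
      by (simp add: midpoint_def scaleR_2[symmetric])
    moreover have "v + t *\<^sub>R (y - v) \<noteq> v + (- t) *\<^sub>R (y - v)"
    proof
      assume "v + t *\<^sub>R (y - v) = v + (- t) *\<^sub>R (y - v)"
      then have "(2 * t) *\<^sub>R (y - v) = 0"
        by (simp add: algebra_simps scaleR_2[symmetric] mult_2)
      then show False using t(1) \<open>y \<noteq> v\<close> by simp
    qed
    ultimately have "v \<in> open_segment (v + t *\<^sub>R (y - v)) (v + (- t) *\<^sub>R (y - v))"
      by (metis midpoint_in_open_segment)
    then show False
      using assms(2) mem[of t] mem[of "- t"] t(1) by (auto simp: extreme_point_of_def)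
  qed
  moreover have "v \<in> (\<Inter>i\<in>I. affine hull (D i))"
    using ri(1) rel_interior_subset hull_subset by (metis INT_I subsetD)
  ultimately show ?thesis by blast
qed

text \<open>Greedy choice: as long as the intersection is larger than \<open>{v}\<close>, some
  member of \<open>\<A>\<close> cuts it properly and lowers its dimension by at least one.\<close>

lemma affine_Inter_singleton_list:
  fixes \<A> :: "'a::euclidean_space set set"
  assumes "\<And>A. A \<in> \<A> \<Longrightarrow> affine A" "\<Inter>\<A> = {v}"
  obtains As where "set As \<subseteq> \<A>" "length As = DIM('a)" "\<Inter>(set As) = {v}"
proof -
  have "\<A> \<noteq> {}"
  proof
    assume "\<A> = {}"
    then have "(UNIV :: 'a set) = {v}" using assms(2) by simp
    then have "aff_dim (UNIV :: 'a set) = aff_dim {v}" by (rule arg_cong)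
    then show False by simp
  qed
  have v: "v \<in> A" if "A \<in> \<A>" for A using that assms(2) by blast
  have "\<exists>As. set As \<subseteq> \<A> \<and> length As = k \<and> aff_dim (\<Inter>(set As)) \<le> int (DIM('a)) - int k"
    if "k \<le> DIM('a)" for k
    using that
  proof (induction k)
    case 0
    then show ?case by (intro exI[of _ "[]"]) (simp add: aff_dim_le_DIM)
  next
    case (Suc k)
    then obtain As where As: "set As \<subseteq> \<A>" "length As = k" "aff_dim (\<Inter>(set As)) \<le> int (DIM('a)) - int k"
      by auto
    have aff: "affine (\<Inter>(set As))" using As(1) assms(1) by blast
    show ?case
    proof (cases "\<Inter>(set As) = {v}")
      case True
      \<comment> \<open>The point is reached early, so the list is padded with an arbitrary member
        to get the exact length.\<close>
      obtain A where A: "A \<in> \<A>" using \<open>\<A> \<noteq> {}\<close> by blast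
      then have "\<Inter>(set (A # As)) = {v}" using True v by auto
      then show ?thesis
        using As A Suc.prems by (intro exI[of _ "A # As"]) (auto simp del: Inter_insert)
    next
      case False
      have "\<not> \<Inter>(set As) \<subseteq> \<Inter>\<A>" using False As(1) assms(2) v by blast
      then obtain A where A: "A \<in> \<A>" "\<not> \<Inter>(set As) \<subseteq> A" by blast
      have "affine (A \<inter> \<Inter>(set As))" using aff assms(1)[OF A(1)] by blast
      moreover have "A \<inter> \<Inter>(set As) \<subset> \<Inter>(set As)" using A(2) by blast
      ultimately have "aff_dim (A \<inter> \<Inter>(set As)) < aff_dim (\<Inter>(set As))"
        using aff by (intro aff_dim_psubset) (simp add: hull_same)
      then show ?thesis
        using As A by (intro exI[of _ "A # As"]) auto
    qed
  qed
  from this[of "DIM('a)"] obtain As where As: "set As \<subseteq> \<A>" "length As = DIM('a)" "aff_dim (\<Inter>(set As)) \<le> 0"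
    by auto
  have "v \<in> \<Inter>(set As)" using v As(1) by blast
  then have "aff_dim (\<Inter>(set As)) = 0"
    using As(3) aff_dim_subset[of "{v}" "\<Inter>(set As)"] by simp
  then have "\<Inter>(set As) = {v}" using \<open>v \<in> \<Inter>(set As)\<close> by (metis aff_dim_eq_0 singletonD)
  with As show ?thesis using that by blast
qed

text \<open>Every extreme point of an intersection of simplices on \<open>P\<close> lies in this finite set: it is
  cut out by the affine hulls of \<open>DIM('a)\<close> faces, because intersecting one by one with the hulls
  of its carrier faces can lower the dimension at most \<open>DIM('a)\<close> times.\<close>

definition apexes :: "'a::euclidean_space set \<Rightarrow> 'a set" where
  "apexes P = {v. \<exists>Fs. length Fs = DIM('a) \<and>
     (\<forall>F\<in>set Fs. F \<noteq> {} \<and> F \<subseteq> P \<and> card F \<le> DIM('a) + 1) \<and> (\<Inter>F\<in>set Fs. affine hull F) = {v}}"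

text \<open>An apex is determined by its list of \<open>DIM('a)\<close> faces, and a face is the set
  of entries of a list of \<open>DIM('a) + 1\<close> points of \<open>P\<close>. A smaller face is
  padded by repeating one of its points.\<close>

lemma card_apexes:
  fixes P :: "'a::euclidean_space set"
  assumes "finite P"
  shows "finite (apexes P)" "card (apexes P) \<le> (card P ^ (DIM('a) + 1)) ^ DIM('a)"
proof -
  let ?d = "DIM('a)"
  define \<F> where "\<F> = {F. F \<noteq> {} \<and> F \<subseteq> P \<and> card F \<le> ?d + 1}"
  let ?L = "{xs. set xs \<subseteq> P \<and> length xs = ?d + 1}"
  have sub: "\<F> \<subseteq> set ` ?L"
  proof
    fix F assume F: "F \<in> \<F>"
    then have "finite F" using assms by (auto simp: \<F>_def intro: finite_subset)
    then obtain ys where ys: "set ys = F" "length ys = card F"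
      by (metis finite_distinct_list distinct_card)
    obtain x where x: "x \<in> F" using F by (auto simp: \<F>_def)
    have "set (ys @ replicate (?d + 1 - card F) x) = F" using ys x by (auto simp: set_replicate_conv_if)
    moreover have "length (ys @ replicate (?d + 1 - card F) x) = ?d + 1"
      using ys F by (auto simp: \<F>_def)
    ultimately show "F \<in> set ` ?L"
      using F by (intro image_eqI[of _ _ "ys @ replicate (?d + 1 - card F) x"]) (auto simp: \<F>_def)
  qed
  have fL: "finite ?L" using assms by (rule finite_lists_length_eq)
  have fin: "finite \<F>" using finite_surj[OF fL sub] .
  have "card \<F> \<le> card ?L" using surj_card_le[OF fL sub] .
  then have cF: "card \<F> \<le> card P ^ (?d + 1)" using assms by (simp only: card_lists_length_eq)
  let ?M = "{Fs. set Fs \<subseteq> \<F> \<and> length Fs = ?d}"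
  have sub2: "apexes P \<subseteq> (\<lambda>Fs. the_elem (\<Inter>F\<in>set Fs. affine hull F)) ` ?M"
  proof
    fix v assume "v \<in> apexes P"
    then obtain Fs where Fs: "length Fs = ?d" "\<forall>F\<in>set Fs. F \<noteq> {} \<and> F \<subseteq> P \<and> card F \<le> ?d + 1"
        "(\<Inter>F\<in>set Fs. affine hull F) = {v}"
      unfolding apexes_def by blast
    then show "v \<in> (\<lambda>Fs. the_elem (\<Inter>F\<in>set Fs. affine hull F)) ` ?M"
      by (intro image_eqI[of _ _ Fs]) (auto simp: \<F>_def)
  qed
  have fM: "finite ?M" using fin by (rule finite_lists_length_eq)
  show "finite (apexes P)" using finite_surj[OF fM sub2] .
  have "card (apexes P) \<le> card ?M" using surj_card_le[OF fM sub2] .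
  also have "\<dots> = card \<F> ^ ?d" using fin by (simp only: card_lists_length_eq)
  also have "\<dots> \<le> (card P ^ (?d + 1)) ^ ?d" using cF by (intro power_mono) auto
  finally show "card (apexes P) \<le> (card P ^ (?d + 1)) ^ ?d" .
qed

text \<open>This reduces the control of all points \<open>x\<close> to finitely many. The
  intersection of the simplices is compact, convex and nonempty, so it has an extreme point
  \<open>v\<close>; general position gives each simplex a face with \<open>v\<close> in its relative
  interior.\<close>

lemma apex_dominates:
  fixes P :: "'a::euclidean_space set"
  assumes "finite P" "general_position P"
    and \<S>: "\<S> \<noteq> {}" "\<And>S. S \<in> \<S> \<Longrightarrow> S \<subseteq> P \<and> card S \<le> DIM('a) + 1 \<and> x \<in> convex hull S"
  obtains v where "v \<in> apexes P" "\<And>S. S \<in> \<S> \<Longrightarrow> v \<in> convex hull S"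
proof -
  have fS: "finite S" if "S \<in> \<S>" for S using \<S>(2)[OF that] assms(1) finite_subset by blast
  have fin: "finite \<S>" using \<S>(2) assms(1) by (intro finite_subset[of \<S> "Pow P"]) auto
  let ?Q = "\<Inter>S\<in>\<S>. convex hull S"
  have "compact ?Q"
    using \<S>(1) fS by (intro compact_Inter) (auto simp: compact_convex_hull finite_imp_compact)
  moreover have "convex ?Q" by (intro convex_INT) auto
  moreover have "?Q \<noteq> {}" using \<S>(2) by blast
  ultimately obtain v where v: "v extreme_point_of ?Q" by (rule extreme_point_exists_convex)
  then have vS: "v \<in> convex hull S" if "S \<in> \<S>" for S using that by (auto simp: extreme_point_of_def)
  have "\<forall>S\<in>\<S>. \<exists>F\<subseteq>S. v \<in> rel_interior (convex hull F)"
  proof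
    fix S assume S: "S \<in> \<S>"
    have "\<not> affine_dependent S"
      using assms(2) \<S>(2)[OF S] fS[OF S] by (auto simp: general_position_def)
    then show "\<exists>F\<subseteq>S. v \<in> rel_interior (convex hull F)"
      using convex_hull_rel_interior_subset vS[OF S] by metis
  qed
  then obtain F where F: "\<And>S. S \<in> \<S> \<Longrightarrow> F S \<subseteq> S" "\<And>S. S \<in> \<S> \<Longrightarrow> v \<in> rel_interior (convex hull (F S))"
    by metis
  have "(\<Inter>S\<in>\<S>. affine hull (convex hull (F S))) = {v}"
    by (rule extreme_point_Inter_affine_hulls[OF fin v]) (use F in \<open>auto intro: hull_mono[THEN subsetD]\<close>)
  then have "\<Inter>((\<lambda>S. affine hull (F S)) ` \<S>) = {v}" by simp
  then obtain As where As: "set As \<subseteq> (\<lambda>S. affine hull (F S)) ` \<S>" "length As = DIM('a)" "\<Inter>(set As) = {v}"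
    by (rule affine_Inter_singleton_list[rotated]) auto
  then have "\<forall>A\<in>set As. \<exists>S\<in>\<S>. A = affine hull (F S)" by blast
  \<comment> \<open>The list consists of affine hulls, whereas \<open>apexes\<close> asks for faces;
    \<open>\<sigma>\<close> selects a simplex whose face spans the given hull.\<close>
  then obtain \<sigma> where \<sigma>: "\<And>A. A \<in> set As \<Longrightarrow> \<sigma> A \<in> \<S> \<and> A = affine hull (F (\<sigma> A))"
    by metis
  have "v \<in> apexes P"
    unfolding apexes_def
  proof (intro CollectI exI[of _ "map (\<lambda>A. F (\<sigma> A)) As"] conjI ballI)
    show "length (map (\<lambda>A. F (\<sigma> A)) As) = DIM('a)" using As by simp
    fix G assume "G \<in> set (map (\<lambda>A. F (\<sigma> A)) As)"
    then obtain S where S: "S \<in> \<S>" "G = F S" using \<sigma> by auto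
    show "G \<noteq> {}" using F(2)[OF S(1)] S(2) by auto
    show "G \<subseteq> P" using F(1)[OF S(1)] S(2) \<S>(2)[OF S(1)] by auto
    show "card G \<le> DIM('a) + 1"
      using card_mono[OF fS[OF S(1)] F(1)[OF S(1)]] S(2) \<S>(2)[OF S(1)] by auto
  next
    have "(\<Inter>G\<in>set (map (\<lambda>A. F (\<sigma> A)) As). affine hull G) = \<Inter>(set As)"
      using \<sigma> by (auto simp: image_image)
    then show "(\<Inter>G\<in>set (map (\<lambda>A. F (\<sigma> A)) As). affine hull G) = {v}" using As(3) by simp
  qed
  then show ?thesis using that vS by blast
qed

subsection \<open>Hypergraphs\<close>

text \<open>Without isolated vertices the edges cover \<open>V\<close>. This bounds the number of
  edges from below in terms of \<open>n\<close>.\<close>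

lemma card_vertices_le:
  assumes "uniform_hypergraph k V E" "\<forall>v\<in>V. \<not> isolated_vertex E v"
  shows "finite E" "card V \<le> k * card E"
proof -
  have V: "finite V" "\<And>e. e \<in> E \<Longrightarrow> e \<subseteq> V \<and> card e = k"
    using assms(1) by (auto simp: uniform_hypergraph_def)
  show fin: "finite E" using V by (intro finite_subset[of E "Pow V"]) auto
  have "V \<subseteq> \<Union>E"
  proof
    fix v assume "v \<in> V"
    then have "{e \<in> E. v \<in> e} \<noteq> {}"
      using assms(2) by (auto simp only: isolated_vertex_def hdegree_def card.empty)
    then show "v \<in> \<Union>E" by auto
  qed
  moreover have "\<Union>E \<subseteq> V" using V(2) by blast
  ultimately have "card V = card (\<Union>E)" by (metis subset_antisym)
  also have "\<dots> \<le> (\<Sum>e\<in>E. card e)" using V by (intro card_Union_le_sum_card) 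
  also have "\<dots> = k * card E" using V(2) by simp
  finally show "card V \<le> k * card E" .
qed

text \<open>Only edges through \<open>a\<close> or \<open>b\<close> can change their image, and each
  of these points lies in at most \<open>\<Delta>\<close> edges; a point outside \<open>V\<close>
  lies in none.\<close>

lemma card_edges_agree_off_two:
  assumes "uniform_hypergraph k V E" "finite E" "\<forall>v\<in>V. hdegree E v \<le> \<Delta>"
    and agree: "\<And>u. u \<in> V - {a, b} \<Longrightarrow> f u = f' u"
  shows "card {e \<in> E. Q (f ` e)} \<le> card {e \<in> E. Q (f' ` e)} + 2 * \<Delta>"
proof -
  have V: "\<And>e. e \<in> E \<Longrightarrow> e \<subseteq> V" using assms(1) by (auto simp: uniform_hypergraph_def)
  have deg: "card {e \<in> E. v \<in> e} \<le> \<Delta>" for v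
  proof (cases "v \<in> V")
    case True
    then show ?thesis using assms(3) by (simp add: hdegree_def)
  next
    case False
    then have "{e \<in> E. v \<in> e} = {}" using V by blast
    then show ?thesis by (simp only: card.empty)
  qed
  have "{e \<in> E. Q (f ` e)} \<subseteq> {e \<in> E. Q (f' ` e)} \<union> ({e \<in> E. a \<in> e} \<union> {e \<in> E. b \<in> e})"
  proof
    fix e assume e: "e \<in> {e \<in> E. Q (f ` e)}"
    show "e \<in> {e \<in> E. Q (f' ` e)} \<union> ({e \<in> E. a \<in> e} \<union> {e \<in> E. b \<in> e})"
    proof (cases "a \<in> e \<or> b \<in> e")
      case False
      then have "f ` e = f' ` e" using V e agree by (intro image_cong) auto
      then show ?thesis using e by simp
    qed (use e in auto)
  qed
  then have "card {e \<in> E. Q (f ` e)} \<le> card ({e \<in> E. Q (f' ` e)} \<union> ({e \<in> E. a \<in> e} \<union> {e \<in> E. b \<in> e}))"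
    using assms(2) by (intro card_mono) auto
  also have "\<dots> \<le> card {e \<in> E. Q (f' ` e)} + (card {e \<in> E. a \<in> e} + card {e \<in> E. b \<in> e})"
    by (meson add_left_mono card_Un_le le_trans)
  also have "\<dots> \<le> card {e \<in> E. Q (f' ` e)} + 2 * \<Delta>"
    using deg[of a] deg[of b] by simp
  finally show ?thesis .
qed

text \<open>Linearity of expectation: the image of each edge is a uniformly random
  \<open>k\<close>-subset of \<open>P\<close>.\<close>

lemma sum_bijs_card_edges_le:
  assumes "uniform_hypergraph k V E" "finite E" "finite P" "card V = card P"
    and "real (card {S. S \<subseteq> P \<and> card S = k \<and> Q S}) / real (card P choose k) \<le> c"
  shows "(\<Sum>f\<in>bijs V P. real (card {e \<in> E. Q (f ` e)})) \<le> fact (card V) * (c * card E)"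
proof -
  have V: "finite V" "\<And>e. e \<in> E \<Longrightarrow> e \<subseteq> V \<and> card e = k"
    using assms(1) by (auto simp: uniform_hypergraph_def)
  have fin: "finite (bijs V P)" using V assms by (simp add: finite_bijs)
  have "(\<Sum>f\<in>bijs V P. real (card {e \<in> E. Q (f ` e)}))
      = (\<Sum>f\<in>bijs V P. \<Sum>e\<in>E. of_bool (Q (f ` e)))"
    using assms(2) by (simp add: Int_def)
  also have "\<dots> = (\<Sum>e\<in>E. \<Sum>f\<in>bijs V P. of_bool (Q (f ` e)))"
    by (rule sum.swap)
  also have "\<dots> = (\<Sum>e\<in>E. real (card {f \<in> bijs V P. Q (f ` e)}))"
    using fin by (simp add: Int_def)
  also have "\<dots> \<le> (\<Sum>e\<in>E. fact (card V) * c)"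
  proof (rule sum_mono)
    fix e assume e: "e \<in> E"
    let ?N = "card {f \<in> bijs V P. Q (f ` e)}" and ?M = "card {S. S \<subseteq> P \<and> card S = k \<and> Q S}"
    \<comment> \<open>An edge exists here, so the binomial coefficient is positive and the bound on
      the fraction can be multiplied out.\<close>
    have "k \<le> card P" using V e assms(4) card_mono by metis
    then have pos: "real (card P choose k) > 0" by simp
    have "?N * (card P choose k) = fact (card V) * ?M"
      using card_bijs_image[OF V(1) assms(3,4), of e Q] V(2)[OF e] assms(4) by simp
    from arg_cong[OF this, of real]
    have "real ?N * real (card P choose k) = fact (card V) * real ?M"
      by (simp only: of_nat_mult of_nat_fact)
    also have "\<dots> \<le> fact (card V) * (c * real (card P choose k))"
      using assms(5) pos by (intro mult_left_mono) (simp_all add: divide_le_eq)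
    finally have "real ?N * real (card P choose k) \<le> (fact (card V) * c) * real (card P choose k)"
      by (simp add: mult_ac)
    then show "real ?N \<le> fact (card V) * c" using pos by simp
  qed
  finally show ?thesis by (simp add: mult_ac)
qed

section \<open>The numerical estimate\<close>

text \<open>The left side is the logarithm of the bound on the number of apexes. With
  \<open>y\<close> the cube root of \<open>N\<close>, the hypothesis reads
  \<open>8 * d ^ 3 \<le> \<epsilon> * y / \<Delta>\<close>. Using \<open>ln N \<le> 3 * y\<close>
  and \<open>d + 1 \<le> 2 * d\<close>, the left side is at most \<open>6 * y * d\<^sup>2\<close>
  and the right side at least \<open>8 * y * d ^ 4\<close>.\<close>

lemma exponent_bound:
  fixes \<epsilon> m \<Delta> d N :: real
  assumes "d \<ge> 1" "\<Delta> > 0" "\<epsilon> > 0" "N \<ge> 2 ^ 9 * d ^ 9 * \<Delta> ^ 3 / \<epsilon> ^ 3" "N \<le> (d + 1) * m"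
  shows "d * (d + 1) * ln N \<le> (\<epsilon> * m)\<^sup>2 / (2 * N * \<Delta>\<^sup>2)"
proof -
  have "2 ^ 9 * d ^ 9 * \<Delta> ^ 3 / \<epsilon> ^ 3 > 0" using assms by simp
  then have N: "N > 0" using assms(4) by linarith
  define y where "y = root 3 N"
  have y: "y > 0" "y ^ 3 = N" using N by (auto simp: y_def)
  have "(8 * d ^ 3 * \<Delta> / \<epsilon>) ^ 3 \<le> y ^ 3"
    using assms(4) y(2) by (simp add: power_mult_distrib power_divide flip: power_mult)
  then have "8 * d ^ 3 * \<Delta> / \<epsilon> \<le> y"
    using y(1) assms by (subst (asm) power_mono_iff) auto
  then have yd: "8 * d ^ 3 \<le> \<epsilon> * y / \<Delta>" using assms by (simp add: field_simps)
  have "ln N = 3 * ln y" using y by (simp add: ln_realpow flip: y(2))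
  also have "\<dots> \<le> 3 * y" using ln_le_minus_one[OF y(1)] by simp
  finally have lnN: "ln N \<le> 3 * y" .
  have "d * (d + 1) * ln N \<le> d * (d + 1) * (3 * y)"
    using assms lnN by (intro mult_left_mono) auto
  also have "\<dots> \<le> d * (2 * d) * (3 * y)"
    using assms y by (intro mult_right_mono mult_left_mono) auto
  also have "\<dots> = 6 * y * d\<^sup>2" by (simp add: power2_eq_square)
  also have "\<dots> \<le> 8 * y * d ^ 4"
    using assms y power_increasing[of 2 4 d] by (intro mult_mono) auto
  also have "\<dots> = (8 * d ^ 3)\<^sup>2 * y / (8 * d\<^sup>2)"
    using assms by (simp add: field_simps flip: power_add power_mult)
  also have "\<dots> \<le> (\<epsilon> * y / \<Delta>)\<^sup>2 * y / (8 * d\<^sup>2)"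
    using yd y assms by (intro divide_right_mono mult_right_mono power_mono) auto
  also have "\<dots> = (\<epsilon> * (N / (2 * d)))\<^sup>2 / (2 * N * \<Delta>\<^sup>2)"
    using y assms by (simp add: field_simps power2_eq_square power3_eq_cube flip: y(2))
  also have "\<dots> \<le> (\<epsilon> * m)\<^sup>2 / (2 * N * \<Delta>\<^sup>2)"
  proof -
    have "0 \<le> m" using N assms by (smt (verit) zero_less_mult_iff)
    then have "(d + 1) * m \<le> (2 * d) * m" using assms by (intro mult_right_mono) auto
    then have "N / (2 * d) \<le> m" using assms by (simp add: field_simps)
    then show ?thesis
      using N assms by (intro divide_right_mono power_mono mult_left_mono) auto
  qed
  finally show ?thesis .
qed

section \<open>The union bound over the apexes\<close>

theorem theorem9p1:
  fixes d \<Delta> n :: nat and \<epsilon> c :: real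
    and V :: "'v set" and E :: "'v set set"
    and P :: "(real ^ 'd) set"
  assumes "CARD('d) = d"
    and "\<Delta> > 0"
    and "\<epsilon> > 0"
    and "real n \<ge> 2 ^ 9 * real d ^ 9 * real \<Delta> ^ 3 / \<epsilon> ^ 3"
    and "uniform_hypergraph (d + 1) V E"
    and "card V = n"
    and "\<forall>v\<in>V. hdegree E v \<le> \<Delta>"
    and "\<forall>v\<in>V. \<not> isolated_vertex E v"
    and "finite P"
    and "card P = n"
    and "general_position P"
    and "\<forall>x :: real ^ 'd.
           real (card {S. S \<subseteq> P \<and> card S = d + 1 \<and> x \<in> convex hull S})
             / real (n choose (d + 1)) \<le> c"
  shows "\<exists>f. bij_betw f V P \<and>
           (\<forall>x :: real ^ 'd.
              real (card {e \<in> E. x \<in> convex hull (f ` e)}) / real (card E) \<le> c + \<epsilon>)"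
proof -
  have dim: "DIM(real ^ 'd) = d" and d: "d \<ge> 1"
    using assms(1) by (auto simp flip: assms(1) simp: Suc_le_eq)
  have V: "finite V" "\<And>e. e \<in> E \<Longrightarrow> e \<subseteq> V \<and> card e = d + 1"
    using assms(5) by (auto simp: uniform_hypergraph_def)
  have E: "finite E" "n \<le> (d + 1) * card E"
    using card_vertices_le[OF assms(5,8)] assms(6) by auto
  have "2 ^ 9 * real d ^ 9 * real \<Delta> ^ 3 / \<epsilon> ^ 3 > 0" using assms(2,3) d by simp
  then have n: "n > 0" using assms(4) by linarith
  then have m: "card E > 0" using E(2) by (cases "card E") auto
  have VP: "card V = card P" using assms(6,10) by simp
  \<comment> \<open>Nonnegativity of \<open>c\<close> comes from testing the hypothesis at the
    origin; it settles points that lie in no simplex of an edge.\<close>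
  have "0 \<le> real (card {S. S \<subseteq> P \<and> card S = d + 1 \<and> 0 \<in> convex hull S}) / real (n choose (d + 1))"
    by simp
  then have c: "c \<ge> 0" using assms(12) order_trans by blast

  define g where "g x f = real (card {e \<in> E. x \<in> convex hull (f ` e)})" for x :: "real ^ 'd" and f
  define \<mu> where "\<mu> x = (\<Sum>f\<in>bijs V P. g x f) / fact n" for x
  define t where "t = \<epsilon> * card E"
  \<comment> \<open>With oscillation \<open>2 * \<Delta>\<close> the logarithm of the normalized
    moment is at most \<open>n * l\<^sup>2 * \<Delta>\<^sup>2 / 2\<close>. This \<open>l\<close>
    minimizes that bound minus \<open>l * t\<close>, and the bound becomes
    \<open>l * t / 2\<close>.\<close>
  define l where "l = t / (n * (real \<Delta>)\<^sup>2)"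
  have t: "t > 0" using assms(3) m by (simp add: t_def)
  have l: "l > 0" using t n assms(2) by (simp add: l_def)

  have \<mu>: "\<mu> x \<le> c * card E" for x
    using sum_bijs_card_edges_le[OF assms(5) E(1) assms(9) VP, of "\<lambda>S. x \<in> convex hull S" c] assms(6,10,12)
    by (simp add: \<mu>_def g_def divide_le_eq mult.commute)

  have moment: "(\<Sum>f\<in>bijs V P. exp (l * (g x f - \<mu> x))) \<le> fact n * exp (l * t / 2)" for x
  proof -
    have swap: "g x f - g x f' \<le> 2 * real \<Delta>" if "\<And>u. u \<in> V - {a, b} \<Longrightarrow> f u = f' u" for f f' a b
    proof -
      have "card {e \<in> E. x \<in> convex hull (f ` e)} \<le> card {e \<in> E. x \<in> convex hull (f' ` e)} + 2 * \<Delta>"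
        using card_edges_agree_off_two[OF assms(5) E(1) assms(7), of a b f f' "\<lambda>S. x \<in> convex hull S"]
          that by blast
      then show ?thesis unfolding g_def by linarith
    qed
    have "(\<Sum>f\<in>bijs V P. exp (l * (g x f - \<mu> x))) \<le> fact n * exp (n * (l\<^sup>2 * (2 * real \<Delta>)\<^sup>2 / 8))"
      unfolding \<mu>_def assms(6)[symmetric] by (rule exp_moment_bijs[OF V(1) assms(9) VP l _ swap]) auto
    also have "n * (l\<^sup>2 * (2 * real \<Delta>)\<^sup>2 / 8) = l * (l * (n * (real \<Delta>)\<^sup>2)) / 2"
      by (simp add: power2_eq_square)
    also have "l * (n * (real \<Delta>)\<^sup>2) = t"
      using n assms(2) by (simp add: l_def)
    finally show ?thesis .
  qed

  have T: "finite (apexes P)" "real (card (apexes P)) \<le> exp (l * t / 2)"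
  proof -
    show "finite (apexes P)" using card_apexes(1)[OF assms(9)] .
    have "real (card (apexes P)) \<le> real ((n ^ (d + 1)) ^ d)"
      using card_apexes(2)[OF assms(9)] dim assms(10) by (simp only: of_nat_le_iff)
    also have "\<dots> = real n ^ (d * (d + 1))"
      by (simp only: of_nat_power power_mult[symmetric] mult.commute)
    also have "\<dots> = exp (real d * (real d + 1) * ln n)"
      using n exp_of_nat_mult[of "d * (d + 1)" "ln (real n)"] by (simp add: algebra_simps)
    also have "\<dots> \<le> exp ((\<epsilon> * card E)\<^sup>2 / (2 * real n * (real \<Delta>)\<^sup>2))"
    proof -
      have "real n \<le> real ((d + 1) * card E)" using E(2) by (simp only: of_nat_le_iff)
      then show ?thesis
        using exponent_bound[of "real d" "real \<Delta>" \<epsilon> "real n" "card E"] assms(2-4) d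
        by (simp add: algebra_simps)
    qed
    also have "(\<epsilon> * card E)\<^sup>2 / (2 * real n * (real \<Delta>)\<^sup>2) = l * t / 2"
      by (simp add: l_def t_def power2_eq_square)
    finally show "real (card (apexes P)) \<le> exp (l * t / 2)" .
  qed

  \<comment> \<open>The number of apexes and the normalized moment are each at most
    \<open>exp (l * t / 2)\<close>, so the average over \<open>f\<close> is at most
    \<open>exp (l * t)\<close>. A non-strict bound suffices, since each single term then forces a
    deviation of at most \<open>t\<close>.\<close>
  have "\<exists>f\<in>bijs V P. (\<Sum>v\<in>apexes P. exp (l * (g v f - \<mu> v))) \<le> exp (l * t)"
  proof (rule ccontr)
    assume "\<not> ?thesis"
    then have less: "exp (l * t) < (\<Sum>v\<in>apexes P. exp (l * (g v f - \<mu> v)))" if "f \<in> bijs V P" for f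
      using that by force
    have cb: "card (bijs V P) = fact n" using card_bijs[OF V(1) assms(9) VP] assms(6) by simp
    then have "bijs V P \<noteq> {}" by (metis card.empty fact_nonzero)
    have "fact n * exp (l * t) = (\<Sum>f\<in>bijs V P. exp (l * t))" using cb by simp
    also have "\<dots> < (\<Sum>f\<in>bijs V P. \<Sum>v\<in>apexes P. exp (l * (g v f - \<mu> v)))"
      using less \<open>bijs V P \<noteq> {}\<close> finite_bijs[OF V(1) assms(9)] by (intro sum_strict_mono)
    also have "\<dots> = (\<Sum>v\<in>apexes P. \<Sum>f\<in>bijs V P. exp (l * (g v f - \<mu> v)))"
      by (rule sum.swap)
    also have "\<dots> \<le> card (apexes P) * (fact n * exp (l * t / 2))"
      by (rule sum_bounded_above[OF moment])
    also have "\<dots> \<le> exp (l * t / 2) * (fact n * exp (l * t / 2))"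
      using T(2) by (intro mult_right_mono) auto
    also have "\<dots> = fact n * exp (l * t)"
      by (simp flip: exp_add)
    finally show False by simp
  qed
  then obtain f where f: "f \<in> bijs V P" "(\<Sum>v\<in>apexes P. exp (l * (g v f - \<mu> v))) \<le> exp (l * t)"
    by blast
  have bij: "bij_betw f V P" using f(1) by (simp add: bijs_def)

  have apex: "g v f \<le> (c + \<epsilon>) * card E" if "v \<in> apexes P" for v
  proof -
    have "exp (l * (g v f - \<mu> v)) \<le> (\<Sum>v\<in>apexes P. exp (l * (g v f - \<mu> v)))"
      using that T(1) by (intro member_le_sum) auto
    then have "exp (l * (g v f - \<mu> v)) \<le> exp (l * t)" using f(2) by linarith
    then have "g v f - \<mu> v \<le> t" using l by simp
    then show ?thesis using \<mu>[of v] by (simp add: t_def algebra_simps)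
  qed

  have "g x f \<le> (c + \<epsilon>) * card E" for x
  proof (cases "{e \<in> E. x \<in> convex hull (f ` e)} = {}")
    case True
    then have "g x f = 0" by (simp only: g_def card.empty of_nat_0)
    then show ?thesis using c assms(3) by simp
  next
    case False
    have fe: "f ` e \<subseteq> P \<and> card (f ` e) \<le> DIM(real ^ 'd) + 1" if "e \<in> E" for e
      using V(2)[OF that] bij dim card_image_le[of e f] finite_subset[OF _ V(1), of e]
      by (auto simp: bij_betw_def)
    \<comment> \<open>Every edge simplex that contains \<open>x\<close> also contains
      \<open>v\<close>, so the count at \<open>x\<close> is at most the count at the apex
      \<open>v\<close>.\<close>
    obtain v where v: "v \<in> apexes P"
        "\<And>S. S \<in> (`) f ` {e \<in> E. x \<in> convex hull (f ` e)} \<Longrightarrow> v \<in> convex hull S"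
      by (rule apex_dominates[OF assms(9,11), of "(`) f ` {e \<in> E. x \<in> convex hull (f ` e)}" x])
        (use False fe in auto)
    have "g x f \<le> g v f"
      unfolding g_def using v(2) E(1) by (intro of_nat_mono card_mono) auto
    then show ?thesis using apex[OF v(1)] by linarith
  qed
  then have "\<forall>x. real (card {e \<in> E. x \<in> convex hull (f ` e)}) / real (card E) \<le> c + \<epsilon>"
    using m by (simp add: g_def divide_le_eq)
  with bij show ?thesis by blast
qed

end
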